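(* Let $X$ be a finite set of cardinality $n$ and let $N=\binom{n}{2}$. The number of two-value magmas on $X$ that are idempotent elements of $\mathcal{M}(X)$ is exactly $$\sum_{m=0}^N\binom{N}{m}2^{N-m}=3^N.$$
   Context: $\mathcal{M}(X)=X^{X\times X}$ is the set of all binary operations on $X$, a monoid under $\triangleright$ defined by $a(\circ\triangleright\ast)b=(a\circ b)\ast(b\circ a)$ for all $a,b\in X$. An element $\ast\in\mathcal{M}(X)$ is idempotent if $\ast\triangleright\ast=\ast$. A binary operation $\ast\in\mathcal{M}(X)$ is called a two-value magma (two-valued magma) if $x\ast y\in\{x,y\}$ for all $x,y\in X$. *)

theory Defs
  imports "HOL-Algebra.Group" "HOL-Library.FuncSet"
begin

text \<open>
  A binary operation on \<open>X\<close> is an extensional function on \<open>X \<times> X\<close>, so that two operations are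
  equal as HOL functions iff they agree on \<open>X \<times> X\<close>.
\<close>

definition magma_monoid :: "'a set \<Rightarrow> ('a \<times> 'a \<Rightarrow> 'a) monoid" where
  "magma_monoid X =
    \<lparr>carrier = X \<times> X \<rightarrow>\<^sub>E X,
     mult = (\<lambda>f g. \<lambda>(a, b)\<in>X \<times> X. g (f (a, b), f (b, a))),
     one = (\<lambda>(a, b)\<in>X \<times> X. a)\<rparr>"

definition idempotent_elem :: "('m, 'r) monoid_scheme \<Rightarrow> 'm \<Rightarrow> bool" where
  "idempotent_elem M x \<longleftrightarrow> x \<in> carrier M \<and> x \<otimes>\<^bsub>M\<^esub> x = x"

definition two_value_magma :: "'a set \<Rightarrow> ('a \<times> 'a \<Rightarrow> 'a) \<Rightarrow> bool" where
  "two_value_magma X f \<longleftrightarrow>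
    f \<in> carrier (magma_monoid X) \<and> (\<forall>x\<in>X. \<forall>y\<in>X. f (x, y) \<in> {x, y})"

lemma magma_monoid_mult_apply:
  assumes "a \<in> X" "b \<in> X"
  shows "(f \<otimes>\<^bsub>magma_monoid X\<^esub> g) (a, b) = g (f (a, b), f (b, a))"
  using assms by (simp add: magma_monoid_def)

lemma magma_monoid_one_apply:
  assumes "a \<in> X" "b \<in> X"
  shows "\<one>\<^bsub>magma_monoid X\<^esub> (a, b) = a"
  using assms by (simp add: magma_monoid_def)

lemma magma_monoid_closed:
  assumes "f \<in> carrier (magma_monoid X)" "a \<in> X" "b \<in> X"
  shows "f (a, b) \<in> X"
  using assms by (auto simp: magma_monoid_def)

lemma magma_monoid_eqI:
  assumes "f \<in> carrier (magma_monoid X)" "g \<in> carrier (magma_monoid X)"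
    and "\<And>a b. a \<in> X \<Longrightarrow> b \<in> X \<Longrightarrow> f (a, b) = g (a, b)"
  shows "f = g"
proof (rule PiE_ext)
  show "f \<in> X \<times> X \<rightarrow>\<^sub>E X" "g \<in> X \<times> X \<rightarrow>\<^sub>E X"
    using assms(1,2) by (simp_all add: magma_monoid_def)
  show "f p = g p" if "p \<in> X \<times> X" for p
    using that assms(3) by (cases p) simp
qed

lemma magma_monoid_mult_closed:
  assumes "f \<in> carrier (magma_monoid X)" "g \<in> carrier (magma_monoid X)"
  shows "f \<otimes>\<^bsub>magma_monoid X\<^esub> g \<in> carrier (magma_monoid X)"
proof -
  have "(\<lambda>(a, b)\<in>X \<times> X. g (f (a, b), f (b, a))) \<in> X \<times> X \<rightarrow>\<^sub>E X"
    by (rule restrict_PiE_iff[THEN iffD2])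
       (simp add: magma_monoid_closed[OF assms(1)] magma_monoid_closed[OF assms(2)])
  then show ?thesis
    by (simp add: magma_monoid_def)
qed

lemma magma_monoid_one_closed: "\<one>\<^bsub>magma_monoid X\<^esub> \<in> carrier (magma_monoid X)"
  by (auto simp: magma_monoid_def restrict_PiE_iff)

lemma monoid_magma_monoid: "monoid (magma_monoid X)"
proof (rule monoidI)
  fix f g h
  assume fgh: "f \<in> carrier (magma_monoid X)" "g \<in> carrier (magma_monoid X)"
    "h \<in> carrier (magma_monoid X)"
  show "f \<otimes>\<^bsub>magma_monoid X\<^esub> g \<otimes>\<^bsub>magma_monoid X\<^esub> h
      = f \<otimes>\<^bsub>magma_monoid X\<^esub> (g \<otimes>\<^bsub>magma_monoid X\<^esub> h)"
    by (rule magma_monoid_eqI[where X = X])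
       (simp_all add: fgh magma_monoid_mult_closed magma_monoid_mult_apply magma_monoid_closed)
next
  fix f assume f: "f \<in> carrier (magma_monoid X)"
  show "\<one>\<^bsub>magma_monoid X\<^esub> \<otimes>\<^bsub>magma_monoid X\<^esub> f = f"
    by (rule magma_monoid_eqI[where X = X])
       (simp_all add: f magma_monoid_mult_closed magma_monoid_one_closed
          magma_monoid_mult_apply magma_monoid_one_apply)
  show "f \<otimes>\<^bsub>magma_monoid X\<^esub> \<one>\<^bsub>magma_monoid X\<^esub> = f"
    by (rule magma_monoid_eqI[where X = X])
       (simp_all add: f magma_monoid_mult_closed magma_monoid_one_closed
          magma_monoid_mult_apply magma_monoid_one_apply magma_monoid_closed)
qed (simp_all add: magma_monoid_mult_closed magma_monoid_one_closed)

end

theory Submission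
  imports Defs
begin

text \<open>
  For distinct \<open>x\<close>, \<open>y\<close>, a two-value magma acts on \<open>{(x, y), (y, x)}\<close> as one of two constants, the
  left projection or the right projection; idempotency excludes exactly the right projection.
  The three remaining choices on a two-element set \<open>e\<close> are encoded by a nonempty subset of \<open>e\<close>:
  those elements that are returned when they stand on the left.
\<close>

lemma idempotent_two_value_magma_iff:
  assumes "two_value_magma X f"
  shows "idempotent_elem (magma_monoid X) f \<longleftrightarrow>
    (\<forall>x\<in>X. \<forall>y\<in>X. f (x, y) = x \<or> f (y, x) = y)" (is "_ \<longleftrightarrow> ?R")
proof -
  have val: "f (x, y) = x \<or> f (x, y) = y" if "x \<in> X" "y \<in> X" for x y
    using assms that by (auto simp: two_value_magma_def)
  have f: "f \<in> carrier (magma_monoid X)"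
    using assms by (simp add: two_value_magma_def)
  have "idempotent_elem (magma_monoid X) f \<longleftrightarrow>
      (\<forall>x\<in>X. \<forall>y\<in>X. f (f (x, y), f (y, x)) = f (x, y))"
  proof
    assume "idempotent_elem (magma_monoid X) f"
    then show "\<forall>x\<in>X. \<forall>y\<in>X. f (f (x, y), f (y, x)) = f (x, y)"
      by (metis idempotent_elem_def magma_monoid_mult_apply)
  next
    assume "\<forall>x\<in>X. \<forall>y\<in>X. f (f (x, y), f (y, x)) = f (x, y)"
    then have "f \<otimes>\<^bsub>magma_monoid X\<^esub> f = f"
      by (intro magma_monoid_eqI[OF magma_monoid_mult_closed[OF f f] f])
         (simp add: magma_monoid_mult_apply)
    then show "idempotent_elem (magma_monoid X) f"
      using f by (simp add: idempotent_elem_def)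
  qed
  \<comment> \<open>If the pair \<open>(f (x, y), f (y, x))\<close> is \<open>(x, y)\<close>, the
    equation is trivial; if both entries are some z, it reads \<open>f (z, z) = z\<close>. If it is
    \<open>(y, x)\<close> with x and y distinct, the left side is \<open>f (y, x) = x\<close>, but
    \<open>f (x, y) = y\<close>.\<close>
  also have "\<dots> \<longleftrightarrow> ?R"
    using val by metis
  finally show ?thesis .
qed

definition left_winners :: "'a set \<Rightarrow> ('a \<times> 'a \<Rightarrow> 'a) \<Rightarrow> 'a set \<Rightarrow> 'a set" where
  "left_winners X f = (\<lambda>e\<in>{e. e \<subseteq> X \<and> card e = 2}. {x\<in>e. \<forall>y\<in>e. f (x, y) = x})"

text \<open>On the diagonal \<open>{x, y}\<close> is a singleton, where an extensional
  \<open>g\<close> is \<open>undefined\<close>; this is harmless, as both branches then return the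
  same element.\<close>

definition magma_of_winners :: "'a set \<Rightarrow> ('a set \<Rightarrow> 'a set) \<Rightarrow> 'a \<times> 'a \<Rightarrow> 'a" where
  "magma_of_winners X g = (\<lambda>(x, y)\<in>X \<times> X. if x \<in> g {x, y} then x else y)"

text \<open>A singleton subset encodes the constant with that value, the whole pair the left
  projection. The empty set would encode the right projection.\<close>

lemma bij_betw_left_winners:
  "bij_betw (left_winners X)
    {f. two_value_magma X f \<and> idempotent_elem (magma_monoid X) f}
    (\<Pi>\<^sub>E e\<in>{e. e \<subseteq> X \<and> card e = 2}. Pow e - {{}})" (is "bij_betw _ ?A ?B")
proof (rule bij_betw_byWitness[where f' = "magma_of_winners X"])
  have A_val: "f (x, y) = x \<or> f (x, y) = y" if "f \<in> ?A" "x \<in> X" "y \<in> X" for f x y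
    using that by (auto simp: two_value_magma_def)
  have A_noswap: "f (x, y) = x \<or> f (y, x) = y" if "f \<in> ?A" "x \<in> X" "y \<in> X" for f x y
    using that idempotent_two_value_magma_iff[of X f] by auto
  have A_carrier: "f \<in> carrier (magma_monoid X)" if "f \<in> ?A" for f
    using that by (simp add: two_value_magma_def)
  have B_apply: "g e \<subseteq> e" "g e \<noteq> {}" if "g \<in> ?B" "e \<subseteq> X" "card e = 2" for g e
    using that PiE_mem[of g "{e. e \<subseteq> X \<and> card e = 2}" "\<lambda>e. Pow e - {{}}" e] by auto
  have magma: "two_value_magma X (magma_of_winners X g)" for g
    by (auto simp: two_value_magma_def magma_of_winners_def magma_monoid_def)
  show "\<forall>f\<in>?A. magma_of_winners X (left_winners X f) = f"
  proof
    fix f assume f: "f \<in> ?A"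
    show "magma_of_winners X (left_winners X f) = f"
    proof (rule magma_monoid_eqI[where X = X])
      show "magma_of_winners X (left_winners X f) \<in> carrier (magma_monoid X)"
        using magma by (auto simp: two_value_magma_def)
      fix x y assume xy: "x \<in> X" "y \<in> X"
      show "magma_of_winners X (left_winners X f) (x, y) = f (x, y)"
        \<comment> \<open>Since \<open>f (x, x) = x\<close>, an x missing from the winners of
          \<open>{x, y}\<close> must fail against y, so \<open>f (x, y)\<close> is the other
          permitted value y.\<close>
        using xy A_val[OF f, of x x] A_val[OF f, of x y]
        by (cases "x = y") (auto simp: magma_of_winners_def left_winners_def)
    qed (rule A_carrier[OF f])
  qed
  show "\<forall>g\<in>?B. left_winners X (magma_of_winners X g) = g"
  proof
    fix g assume g: "g \<in> ?B"
    show "left_winners X (magma_of_winners X g) = g"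
    proof
      fix e
      show "left_winners X (magma_of_winners X g) e = g e"
      proof (cases "e \<subseteq> X \<and> card e = 2")
        case True
        then obtain a b where ab: "e = {a, b}" "a \<noteq> b"
          by (auto simp: card_2_iff)
        have "left_winners X (magma_of_winners X g) e
            = {x\<in>e. \<forall>y\<in>e. magma_of_winners X g (x, y) = x}"
          using True by (simp add: left_winners_def)
        \<comment> \<open>Members of \<open>g e\<close> are returned on the left by definition; an
          element of \<open>e\<close> outside \<open>g e\<close> yields the other element, which
          differs from it since \<open>a \<noteq> b\<close>.\<close>
        also have "\<dots> = g e"
          using B_apply[OF g, of e] True ab
          by (auto simp: magma_of_winners_def insert_commute split: if_splits)
        finally show ?thesis .
      next
        case False
        then have "g e = undefined"
          using PiE_arb[OF g] by simp
        with False show ?thesis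
          by (auto simp: left_winners_def)
      qed
    qed
  qed
  show "left_winners X ` ?A \<subseteq> ?B"
  proof (rule image_subsetI)
    fix f assume f: "f \<in> ?A"
    have "{x\<in>e. \<forall>y\<in>e. f (x, y) = x} \<noteq> {}" if e: "e \<subseteq> X" "card e = 2" for e
    proof -
      obtain a b where "e = {a, b}" "a \<in> X" "b \<in> X"
        using e by (auto simp: card_2_iff)
      \<comment> \<open>Whichever alternative of \<open>A_noswap\<close> holds names a winner, a or
        b; the diagonal values settle its comparison with itself.\<close>
      then show ?thesis
        using A_noswap[OF f, of a b] A_val[OF f, of a a] A_val[OF f, of b b] by auto
    qed
    then show "left_winners X f \<in> ?B"
      unfolding left_winners_def restrict_PiE_iff by blast
  qed
  show "magma_of_winners X ` ?B \<subseteq> ?A"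
  proof (rule image_subsetI)
    fix g assume g: "g \<in> ?B"
    define f where f: "f = magma_of_winners X g"
    have "f (x, y) = x \<or> f (y, x) = y" if xy: "x \<in> X" "y \<in> X" for x y
    proof (cases "x = y")
      case True
      then show ?thesis
        using xy by (simp add: f magma_of_winners_def)
    next
      case False
      \<comment> \<open>The nonempty set \<open>g {x, y}\<close> contains x or y, and that element
        is returned when it stands on the left.\<close>
      then show ?thesis
        using B_apply[OF g, of "{x, y}"] xy
        by (auto simp: f magma_of_winners_def insert_commute)
    qed
    then have "f \<in> ?A"
      using magma[of g] by (simp add: f idempotent_two_value_magma_iff)
    then show "magma_of_winners X g \<in> ?A"
      by (simp only: f)
  qed
qed

theorem proposition26:
  fixes X :: "'a set" and n N :: nat
  assumes "finite X" and "card X = n" and "N = n choose 2"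
  shows "card {f. two_value_magma X f \<and> idempotent_elem (magma_monoid X) f}
           = (\<Sum>m = 0..N. (N choose m) * 2 ^ (N - m))
       \<and> (\<Sum>m = 0..N. (N choose m) * 2 ^ (N - m)) = (3 :: nat) ^ N"
proof -
  let ?P = "{e. e \<subseteq> X \<and> card e = 2}"
  have fin: "finite ?P"
    using assms(1) by simp
  have "card (Pow e - {{}}) = 3" if "e \<in> ?P" for e :: "'a set"
  proof -
    have "finite e"
      using that by (auto intro: card_ge_0_finite)
    then show ?thesis
      using that by (simp add: card_Diff_singleton card_Pow)
  qed
  then have "card (\<Pi>\<^sub>E e\<in>?P. Pow e - {{}}) = 3 ^ card ?P"
    by (simp add: card_PiE[OF fin])
  also have "card ?P = N"
    using n_subsets[OF assms(1)] assms(2,3) by simp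
  finally have "card {f. two_value_magma X f \<and> idempotent_elem (magma_monoid X) f} = 3 ^ N"
    using bij_betw_same_card[OF bij_betw_left_winners[of X]] by simp
  \<comment> \<open>The binomial theorem for \<open>(1 + 2) ^ N\<close>: m can be read as the number
    of pairs carrying the left projection, with two constants to choose from on each remaining
    pair.\<close>
  moreover have "(\<Sum>m = 0..N. (N choose m) * 2 ^ (N - m)) = (3 :: nat) ^ N"
    using binomial[of 1 2 N] by (simp add: atLeast0AtMost numeral_3_eq_3)
  ultimately show ?thesis
    by simp
qed

end
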